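(* Let $N=|X\setminus A|$. For every $t>0$ and every $f\in\mathcal H_t$, $$\mathrm{Lip}(f)\;\le\;\frac{\pi}{2d_{\min}\sqrt{w_{\min}}}\;\|f\|_{\mathcal H_t}\left(\int_{\mathbb T^{N}}\lambda(\theta)\,e^{-t\lambda(\theta)}\,d\mu(\theta)\right)^{1/2}.$$
   Context: Lipschitz seminorm: for a map $f:(M_1,\rho_1)\to(M_2,\rho_2)$ of metric spaces, $\mathrm{Lip}(f):=\sup_{\alpha\ne\beta}\rho_2(f(\alpha),f(\beta))/\rho_1(\alpha,\beta)\in[0,\infty]$. Setting: $(X,d)$ is a metric space and $A\subseteq X$ is nonempty with $X\setminus A=\{x_1,\dots,x_N\}$ finite, $N\ge1$. Write $d(x,A)=\inf_{a\in A}d(x,a)$ and $d_1(x,y):=\min\{d(x,y),\,d(x,A)+d(y,A)\}$. Let $X/A=\{[A],x_1,\dots,x_N\}$ be the quotient collapsing $A$ to the basepoint $[A]$, and let $\overline d_1$ be the function on $X/A$ induced by $d_1$; it is assumed to be a metric on $X/A$ (equivalently $d(x_j,A)>0$ for all $j$). Diagrams: $D(X,A)$ is the free commutative monoid on $X\setminus A$ (finite multisets of points of $X\setminus A$; the point $[A]$ is identified with $0$). For $\alpha,\beta\in D(X,A)$, $W_1(\alpha,\beta)$ is the infimum of $\sum_{i}\overline d_1(u_i,v_i)$ over all finite multisets $\{(u_i,v_i)\}_i$ of pairs in $(X/A)\times(X/A)$ such that $\sum_i u_i$ equals $\alpha$ and $\sum_i v_i$ equals $\beta$ modulo multiples of $[A]$.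 $K(X,A)$ is the Grothendieck group of $D(X,A)$, identified with the free abelian group $\mathbb Z^{N}$ with basis $e_1,\dots,e_N$, where $e_j$ is the class of $x_j$. It carries the translation-invariant metric $\rho(a-b,c-e):=W_1(a+e,c+b)$ for $a,b,c,e\in D(X,A)$. Characters and phases: $\mathbb T^{N}=\mathbb R^{N}/2\pi\mathbb Z^{N}$ with normalized Haar (Lebesgue) probability measure $\mu$. For $\theta\in\mathbb T^N$, $\chi_\theta:K(X,A)\to S^1\subset\mathbb C$ is $\chi_\theta(\sum_j n_je_j)=\exp(i\sum_j n_j\theta_j)$. The phase function $\phi_\theta:X/A\to S^1$ is $\phi_\theta([A])=1$, $\phi_\theta(x_j)=e^{i\theta_j}$. Graph model: fix a connected (simple, undirected) graph $H=(V,E)$ with $V=X/A$ such that, when each edge $\{u,v\}$ is given length $\overline d_1(u,v)$, the shortest-path metric of $H$ is $\overline d_1$. Fix symmetric conductances $w_{uv}=w_{vu}>0$ for $\{u,v\}\in E$ (not necessarily equal to the lengths), with $w_{uv}=0$ if $\{u,v\}\notin E$. The Dirichlet energy is $\lambda(\theta):=\tfrac12\sum_{u,v\in V}w_{uv}|\phi_\theta(u)-\phi_\theta(v)|^2$, with $|\cdot|$ the complex modulus. Put $w_{\min}=\min_{\{u,v\}\in E}w_{uv}$ and $d_{\min}=\min_{\{u,v\}\in E}\overline d_1(u,v)$. Heat RKHS: for $t>0$, $\nu_t$ is the measure $d\nu_t(\theta)=e^{-t\lambda(\theta)}d\mu(\theta)$ on $\mathbb T^N$, and $k_t(\alpha,\beta)=\int_{\mathbb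 T^N}\chi_\theta(\alpha-\beta)\,d\nu_t(\theta)$ for $\alpha,\beta\in K(X,A)$, a positive definite kernel. $\mathcal H_t$ is the reproducing kernel Hilbert space of complex-valued functions on $K(X,A)$ with kernel $k_t$ (so $f(\alpha)=\langle f,k_t(\cdot,\alpha)\rangle_{\mathcal H_t}$). For $f\in\mathcal H_t$, $\mathrm{Lip}(f)$ is taken with respect to $\rho$ and the usual metric on $\mathbb C$. *)

theory Defs
  imports
    "HOL-Analysis.Analysis"
    "HOL-Probability.Probability"
    "Graph_Theory.Pair_Digraph"
    "Graph_Theory.Digraph_Component"
    "Graph_Theory.Shortest_Path"
begin

section \<open>Lipschitz seminorm\<close>

text \<open>The division is that of \<^typ>\<open>ennreal\<close>, so a positive distance over \<open>0\<close> counts as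
  infinite; for metrics this case does not occur.\<close>

definition Lip :: "('a \<Rightarrow> 'a \<Rightarrow> real) \<Rightarrow> ('b \<Rightarrow> 'b \<Rightarrow> real) \<Rightarrow> ('a \<Rightarrow> 'b) \<Rightarrow> ennreal" where
  "Lip d1 d2 f =
     (SUP (\<alpha>, \<beta>) \<in> {(\<alpha>, \<beta>). \<alpha> \<noteq> \<beta>}. ennreal (d2 (f \<alpha>) (f \<beta>)) / ennreal (d1 \<alpha> \<beta>))"

section \<open>The quotient of a metric space by a cofinite subset\<close>

text \<open>
  The ambient metric space is a type \<open>'a\<close> of class \<^class>\<open>metric_space\<close>. The finitely many points
  outside \<open>A\<close> are enumerated by a bijection \<open>x\<close> from a finite type \<open>'n\<close> onto \<open>- A\<close>, so
  \<open>N = CARD('n) \<ge> 1\<close>. The quotient \<open>X/A\<close> is the type \<open>'n option\<close>: \<open>None\<close> is the basepoint \<open>[A]\<close>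
  and \<open>Some j\<close> is the point \<open>x j\<close>.
\<close>

definition d1 :: "'a::metric_space set \<Rightarrow> 'a \<Rightarrow> 'a \<Rightarrow> real" where
  "d1 A y z = min (dist y z) (infdist y A + infdist z A)"

definition quot_proj :: "'a set \<Rightarrow> ('n \<Rightarrow> 'a) \<Rightarrow> 'a \<Rightarrow> 'n option" where
  "quot_proj A x y = (if y \<in> A then None else Some (inv x y))"

definition quot_rep :: "'a set \<Rightarrow> ('n \<Rightarrow> 'a) \<Rightarrow> 'n option \<Rightarrow> 'a" where
  "quot_rep A x u = (case u of None \<Rightarrow> (SOME a. a \<in> A) | Some j \<Rightarrow> x j)"

definition d1_quot ::
  "'a::metric_space set \<Rightarrow> ('n \<Rightarrow> 'a) \<Rightarrow> 'n option \<Rightarrow> 'n option \<Rightarrow> real" where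
  "d1_quot A x u v = d1 A (quot_rep A x u) (quot_rep A x v)"

lemma d1_basepoint:
  assumes "a \<in> A" "b \<in> A"
  shows "d1 A a z = infdist z A" "d1 A z a = infdist z A" "d1 A a b = 0"
proof -
  have "infdist z A \<le> dist z a" by (rule infdist_le) (fact assms)
  then show "d1 A a z = infdist z A" "d1 A z a = infdist z A"
    using assms by (simp_all add: d1_def dist_commute min_def)
  show "d1 A a b = 0" using assms by (simp add: d1_def)
qed

text \<open>The choice of representative is irrelevant, i.e. \<^const>\<open>d1_quot\<close> is induced by \<^const>\<open>d1\<close>.\<close>

lemma d1_quot_proj:
  assumes "A \<noteq> {}" and "bij_betw x UNIV (- A)"
  shows "d1_quot A x (quot_proj A x y) (quot_proj A x z) = d1 A y z"
proof -
  have a: "(SOME a. a \<in> A) \<in> A" using assms(1) by (simp add: some_in_eq)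
  have r: "x (inv x y) = y" if "y \<notin> A" for y
    using assms(2) that by (metis ComplI bij_betw_imp_surj_on f_inv_into_f)
  show ?thesis
    using a r by (auto simp: d1_quot_def quot_proj_def quot_rep_def d1_basepoint)
qed

section \<open>Diagrams and the 1-Wasserstein distance\<close>

text \<open>Diagrams are multisets over \<open>'n\<close>. \<open>is_diagram U \<alpha>\<close>: the sum \<open>U\<close> of points of \<open>X/A\<close> equals
  \<open>\<alpha>\<close> modulo multiples of the basepoint.\<close>

definition is_diagram :: "'n option multiset \<Rightarrow> 'n multiset \<Rightarrow> bool" where
  "is_diagram U \<alpha> \<longleftrightarrow> (\<exists>m. U = image_mset Some \<alpha> + replicate_mset m None)"

definition couplings :: "'n multiset \<Rightarrow> 'n multiset \<Rightarrow> ('n option \<times> 'n option) multiset set" where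
  "couplings \<alpha> \<beta> = {M. is_diagram (image_mset fst M) \<alpha> \<and> is_diagram (image_mset snd M) \<beta>}"

definition W1 :: "('n option \<Rightarrow> 'n option \<Rightarrow> real) \<Rightarrow> 'n multiset \<Rightarrow> 'n multiset \<Rightarrow> real" where
  "W1 d \<alpha> \<beta> = (INF M \<in> couplings \<alpha> \<beta>. \<Sum>(u, v)\<in>#M. d u v)"

section \<open>The Grothendieck group\<close>

text \<open>The Grothendieck group \<open>K(X,A)\<close> is \<open>int ^ 'n\<close>, with \<open>axis j 1\<close> the class of \<open>x j\<close>.\<close>

definition diagram_class :: "'n multiset \<Rightarrow> int ^ 'n" where
  "diagram_class \<alpha> = (\<Sum>j\<in>#\<alpha>. axis j 1)"

definition rho :: "('n option \<Rightarrow> 'n option \<Rightarrow> real) \<Rightarrow> int ^ 'n \<Rightarrow> int ^ 'n \<Rightarrow> real" where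
  "rho d k l = (THE r. \<exists>a b c e. k = diagram_class a - diagram_class b
                        \<and> l = diagram_class c - diagram_class e \<and> r = W1 d (a + e) (c + b))"

lemma diagram_class_nth: "diagram_class \<alpha> $ j = int (count \<alpha> j)"
  by (induction \<alpha>) (auto simp: diagram_class_def axis_def)

lemma diagram_class_add: "diagram_class (\<alpha> + \<beta>) = diagram_class \<alpha> + diagram_class \<beta>"
  by (simp add: diagram_class_def)

lemma diagram_class_eq_iff: "diagram_class \<alpha> = diagram_class \<beta> \<longleftrightarrow> \<alpha> = \<beta>"
  by (simp add: vec_eq_iff diagram_class_nth multiset_eq_iff)

lemma exists_diagram_difference:
  fixes k :: "int ^ 'n::finite"
  shows "\<exists>a b. k = diagram_class a - diagram_class b"
proof -
  have "k = diagram_class (Abs_multiset (\<lambda>j. nat (k $ j)))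
            - diagram_class (Abs_multiset (\<lambda>j. nat (- (k $ j))))"
    by (simp add: vec_eq_iff diagram_class_nth)
  then show ?thesis by blast
qed

lemma is_diagram_iff: "is_diagram U \<alpha> \<longleftrightarrow> (\<forall>j. count U (Some j) = count \<alpha> j)"
proof
  have c: "count (image_mset Some \<alpha>) (Some j) = count \<alpha> j" for j
    by (induction \<alpha>) auto
  have n: "count (image_mset Some \<alpha>) None = 0"
    by (induction \<alpha>) auto
  show "\<forall>j. count U (Some j) = count \<alpha> j" if "is_diagram U \<alpha>"
    using that by (auto simp: is_diagram_def c)
  show "is_diagram U \<alpha>" if *: "\<forall>j. count U (Some j) = count \<alpha> j"
  proof -
    have "U = image_mset Some \<alpha> + replicate_mset (count U None) None"
    proof (rule multiset_eqI)
      fix u show "count U u = count (image_mset Some \<alpha> + replicate_mset (count U None) None) u"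
        using * by (cases u) (simp_all add: c n)
    qed
    then show ?thesis by (auto simp: is_diagram_def)
  qed
qed

lemma couplings_ne: "couplings \<alpha> \<beta> \<noteq> {}"
proof -
  have "image_mset (\<lambda>j. (Some j, None)) \<alpha> + image_mset (\<lambda>j. (None, Some j)) \<beta> \<in> couplings \<alpha> \<beta>"
    by (auto simp: couplings_def is_diagram_def multiset.map_comp comp_def image_mset_const_eq
             intro: exI[of _ "size \<alpha>"] exI[of _ "size \<beta>"])
  then show ?thesis by blast
qed

text \<open>Cancellation for \<^const>\<open>W1\<close>: mass that passes through a common point can be rerouted.\<close>

lemma W1_cancel_single:
  assumes "Metric_space UNIV d"
  shows "W1 d (add_mset j \<alpha>) (add_mset j \<beta>) = W1 d \<alpha> \<beta>"
proof -
  interpret Metric_space UNIV d by fact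
  let ?c = "\<lambda>M. \<Sum>(u, v)\<in>#M. d u v"
  have nonneg_cost: "0 \<le> ?c M" for M
    by (induction M) auto
  have bdd: "bdd_below (?c ` S)" for S
    by (rule bdd_belowI2[of _ 0]) (rule nonneg_cost)
  have le: "\<exists>M'\<in>couplings \<alpha> \<beta>. ?c M' \<le> ?c M" if M: "M \<in> couplings (add_mset j \<alpha>) (add_mset j \<beta>)" for M
  proof -
    have cf: "count (image_mset fst M) (Some i) = count (add_mset j \<alpha>) i"
     and cs: "count (image_mset snd M) (Some i) = count (add_mset j \<beta>) i" for i
      using M unfolding couplings_def is_diagram_iff by auto
    have "Some j \<in># image_mset fst M"
      using cf[of j] by (metis count_add_mset count_eq_zero_iff nat.distinct(1))
    then obtain v where "(Some j, v) \<in># M" by auto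
    then obtain M1 where M1: "M = add_mset (Some j, v) M1" by (metis insert_DiffM)
    show ?thesis
    proof (cases "v = Some j")
      case True
      have "count (image_mset fst M1) (Some i) = count \<alpha> i"
       and "count (image_mset snd M1) (Some i) = count \<beta> i" for i
        using cf[of i] cs[of i] by (auto simp: M1 True split: if_splits)
      then have "M1 \<in> couplings \<alpha> \<beta>"
        unfolding couplings_def is_diagram_iff by auto
      then show ?thesis using M1 by (auto intro!: bexI[of _ M1])
    next
      case False
      have "Some j \<in># image_mset snd M"
        using cs[of j] by (metis count_add_mset count_eq_zero_iff nat.distinct(1))
      then obtain u where "(u, Some j) \<in># M1" using False M1 by auto
      then obtain M2 where M2: "M1 = add_mset (u, Some j) M2" by (metis insert_DiffM)
      let ?M = "add_mset (u, v) M2"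
      have "count (image_mset fst ?M) (Some i) = count \<alpha> i" for i
        using cf[of i] by (auto simp: M1 M2 split: if_splits)
      moreover have "count (image_mset snd ?M) (Some i) = count \<beta> i" for i
        using cs[of i] by (auto simp: M1 M2 split: if_splits)
      ultimately have "?M \<in> couplings \<alpha> \<beta>"
        unfolding couplings_def is_diagram_iff by auto
      moreover have "?c ?M \<le> ?c M"
        using triangle[of u "Some j" v] by (simp add: M1 M2)
      ultimately show ?thesis by blast
    qed
  qed
  have ge: "\<exists>M'\<in>couplings (add_mset j \<alpha>) (add_mset j \<beta>). ?c M' \<le> ?c M" if "M \<in> couplings \<alpha> \<beta>" for M
    using that by (intro bexI[of _ "add_mset (Some j, Some j) M"])
      (auto simp: couplings_def is_diagram_iff)
  show ?thesis
    unfolding W1_def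
  proof (rule antisym)
    show "(INF M \<in> couplings (add_mset j \<alpha>) (add_mset j \<beta>). ?c M) \<le> (INF M \<in> couplings \<alpha> \<beta>. ?c M)"
      by (rule cINF_mono[OF couplings_ne bdd ge])
    show "(INF M \<in> couplings \<alpha> \<beta>. ?c M) \<le> (INF M \<in> couplings (add_mset j \<alpha>) (add_mset j \<beta>). ?c M)"
      by (rule cINF_mono[OF couplings_ne bdd le])
  qed
qed

lemma W1_cancel:
  assumes "Metric_space UNIV d"
  shows "W1 d (\<alpha> + \<gamma>) (\<beta> + \<gamma>) = W1 d \<alpha> \<beta>"
  by (induction \<gamma>) (simp_all add: W1_cancel_single[OF assms])

lemma rho_eq:
  assumes "Metric_space UNIV d"
  shows "rho d (diagram_class a - diagram_class b) (diagram_class c - diagram_class e)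
           = W1 d (a + e) (c + b)"
  unfolding rho_def
proof (rule the_equality)
  fix r
  assume "\<exists>a' b' c' e'. diagram_class a - diagram_class b = diagram_class a' - diagram_class b' \<and>
    diagram_class c - diagram_class e = diagram_class c' - diagram_class e' \<and>
    r = W1 d (a' + e') (c' + b')"
  then obtain a' b' c' e' where
    "diagram_class a + diagram_class b' = diagram_class a' + diagram_class b"
    "diagram_class c + diagram_class e' = diagram_class c' + diagram_class e"
    and r: "r = W1 d (a' + e') (c' + b')"
    by (metis (no_types, lifting) add.commute diff_add_eq diff_eq_eq)
  then have 1: "a + b' = a' + b" and 2: "c + e' = c' + e"
    by (simp_all flip: diagram_class_add add: diagram_class_eq_iff)
  have "W1 d (a + e) (c + b) = W1 d ((a + e) + (b' + e')) ((c + b) + (b' + e'))"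
    by (simp only: W1_cancel[OF assms])
  also have "(a + e) + (b' + e') = (a' + e') + (b + e)"
    using 1 by (metis add.assoc add.commute)
  also have "(c + b) + (b' + e') = (c' + b') + (b + e)"
    using 2 by (metis add.assoc add.commute)
  finally show "r = W1 d (a + e) (c + b)"
    by (simp only: W1_cancel[OF assms] r)
qed blast

section \<open>Characters, phases and the Dirichlet energy\<close>

text \<open>Points of the torus \<open>\<real>\<^sup>N/2\<pi>\<int>\<^sup>N\<close> are given by vectors of angles; Haar probability measure is
  normalised Lebesgue measure on the fundamental box \<open>[0,2\<pi>)\<^sup>N\<close>.\<close>

definition torus_haar :: "(real ^ 'n) measure" where
  "torus_haar = uniform_measure lborel {\<theta>. \<forall>j. 0 \<le> \<theta> $ j \<and> \<theta> $ j < 2 * pi}"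

definition character :: "real ^ 'n \<Rightarrow> int ^ 'n \<Rightarrow> complex" where
  "character \<theta> k = exp (\<i> * of_real (\<Sum>j\<in>UNIV. of_int (k $ j) * \<theta> $ j))"

definition phase :: "real ^ 'n \<Rightarrow> 'n option \<Rightarrow> complex" where
  "phase \<theta> u = (case u of None \<Rightarrow> 1 | Some j \<Rightarrow> exp (\<i> * of_real (\<theta> $ j)))"

definition dirichlet_energy ::
  "('n::finite option \<Rightarrow> 'n option \<Rightarrow> real) \<Rightarrow> real ^ 'n \<Rightarrow> real" where
  "dirichlet_energy w \<theta> =
     1 / 2 * (\<Sum>u\<in>UNIV. \<Sum>v\<in>UNIV. w u v * (cmod (phase \<theta> u - phase \<theta> v))\<^sup>2)"

section \<open>Weighted graphs on the quotient\<close>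

text \<open>A simple undirected graph is a symmetric loop-free digraph without parallel arcs
  (\<^locale>\<open>pair_graph\<close>); the edge \<open>{u,v}\<close> is represented by the arcs \<open>(u,v)\<close> and \<open>(v,u)\<close>.\<close>

definition metric_graph ::
  "'v pair_pre_digraph \<Rightarrow> ('v \<Rightarrow> 'v \<Rightarrow> real) \<Rightarrow> bool" where
  "metric_graph H d \<longleftrightarrow>
     pair_graph H \<and> pverts H = UNIV \<and> Digraph_Component.connected (with_proj H) \<and>
     (\<forall>u v. wf_digraph.\<mu> (with_proj H) (\<lambda>(p, q). d p q) u v = ereal (d u v))"

definition conductances :: "'v pair_pre_digraph \<Rightarrow> ('v \<Rightarrow> 'v \<Rightarrow> real) \<Rightarrow> bool" where
  "conductances H w \<longleftrightarrow>
     (\<forall>u v. w u v = w v u) \<and> (\<forall>u v. (u, v) \<in> parcs H \<longrightarrow> w u v > 0) \<and>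
     (\<forall>u v. (u, v) \<notin> parcs H \<longrightarrow> w u v = 0)"

definition edge_min :: "'v pair_pre_digraph \<Rightarrow> ('v \<Rightarrow> 'v \<Rightarrow> real) \<Rightarrow> real" where
  "edge_min H c = Min ((\<lambda>(u, v). c u v) ` parcs H)"

section \<open>Reproducing kernel Hilbert spaces\<close>

text \<open>\<open>is_rkhs H ip k\<close>: the set \<open>H\<close> of complex-valued functions with inner product \<open>ip\<close> (linear in
  the first argument) is a complex Hilbert space with reproducing kernel \<open>k\<close>. By the
  Moore--Aronszajn theorem, \<open>k\<close> determines \<open>H\<close>, and \<open>ip\<close> on \<open>H\<close>, uniquely.\<close>

definition ip_norm :: "(('x \<Rightarrow> complex) \<Rightarrow> ('x \<Rightarrow> complex) \<Rightarrow> complex) \<Rightarrow> ('x \<Rightarrow> complex) \<Rightarrow> real" where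
  "ip_norm ip f = sqrt (Re (ip f f))"

definition is_complex_hilbert_space ::
  "('x \<Rightarrow> complex) set \<Rightarrow> (('x \<Rightarrow> complex) \<Rightarrow> ('x \<Rightarrow> complex) \<Rightarrow> complex) \<Rightarrow> bool" where
  "is_complex_hilbert_space H ip \<longleftrightarrow>
     (\<lambda>_. 0) \<in> H \<and>
     (\<forall>f\<in>H. \<forall>g\<in>H. (\<lambda>x. f x + g x) \<in> H) \<and>
     (\<forall>c. \<forall>f\<in>H. (\<lambda>x. c * f x) \<in> H) \<and>
     (\<forall>f\<in>H. \<forall>g\<in>H. \<forall>h\<in>H. ip (\<lambda>x. f x + g x) h = ip f h + ip g h) \<and>
     (\<forall>c. \<forall>f\<in>H. \<forall>h\<in>H. ip (\<lambda>x. c * f x) h = c * ip f h) \<and>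
     (\<forall>f\<in>H. \<forall>g\<in>H. ip g f = cnj (ip f g)) \<and>
     (\<forall>f\<in>H. 0 \<le> Re (ip f f)) \<and>
     (\<forall>f\<in>H. ip f f = 0 \<longrightarrow> f = (\<lambda>_. 0)) \<and>
     (\<forall>s. (\<forall>n. s n \<in> H) \<and>
          (\<forall>e>0. \<exists>M. \<forall>m\<ge>M. \<forall>n\<ge>M. ip_norm ip (\<lambda>x. s m x - s n x) < e) \<longrightarrow>
          (\<exists>f\<in>H. (\<lambda>n. ip_norm ip (\<lambda>x. s n x - f x)) \<longlonglongrightarrow> 0))"

definition is_rkhs ::
  "('x \<Rightarrow> complex) set \<Rightarrow> (('x \<Rightarrow> complex) \<Rightarrow> ('x \<Rightarrow> complex) \<Rightarrow> complex) \<Rightarrow>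
   ('x \<Rightarrow> 'x \<Rightarrow> complex) \<Rightarrow> bool" where
  "is_rkhs H ip k \<longleftrightarrow>
     is_complex_hilbert_space H ip \<and>
     (\<forall>\<alpha>. (\<lambda>\<beta>. k \<beta> \<alpha>) \<in> H) \<and>
     (\<forall>f\<in>H. \<forall>\<alpha>. f \<alpha> = ip f (\<lambda>\<beta>. k \<beta> \<alpha>))"

section \<open>The heat kernel\<close>

definition heat_measure ::
  "('n::finite option \<Rightarrow> 'n option \<Rightarrow> real) \<Rightarrow> real \<Rightarrow> (real ^ 'n) measure" where
  "heat_measure w t = density torus_haar (\<lambda>\<theta>. ennreal (exp (- t * dirichlet_energy w \<theta>)))"

definition heat_kernel ::
  "('n::finite option \<Rightarrow> 'n option \<Rightarrow> real) \<Rightarrow> real \<Rightarrow> int ^ 'n \<Rightarrow> int ^ 'n \<Rightarrow> complex" where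
  "heat_kernel w t \<alpha> \<beta> = (\<integral>\<theta>. character \<theta> (\<alpha> - \<beta>) \<partial>heat_measure w t)"

end

theory Submission
  imports Defs
begin

text \<open>
  By the reproducing property and Cauchy--Schwarz, \<open>|f \<alpha> - f \<beta>|\<close> is at most \<open>\<parallel>f\<parallel>\<close> times the norm of
  \<open>k\<^sub>\<alpha> - k\<^sub>\<beta>\<close>, whose square is the integral of \<open>|\<chi>\<^sub>\<theta> \<alpha> - \<chi>\<^sub>\<theta> \<beta>|\<^sup>2\<close> against \<open>\<nu>\<^sub>t\<close>. For fixed \<open>\<theta>\<close>, a single
  edge term of the energy bounds the phase difference across that edge by \<open>sqrt (\<lambda> \<theta> / w\<^sub>m\<^sub>i\<^sub>n)\<close>, so
  the phase is Lipschitz on the graph with constant \<open>sqrt (\<lambda> \<theta> / w\<^sub>m\<^sub>i\<^sub>n) / d\<^sub>m\<^sub>i\<^sub>n\<close>. Products of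
  unimodular numbers differ by at most the sum of the differences of the factors, so transport
  plans carry this constant over to \<open>\<chi>\<^sub>\<theta>\<close> and \<open>\<rho>\<close>. Comparing chords rather than arcs makes the
  factor \<open>\<pi> / 2 \<ge> 1\<close> superfluous.
\<close>

section \<open>Characters, phases and transport plans\<close>

lemma norm_phase [simp]: "cmod (phase \<theta> u) = 1"
  by (cases u) (simp_all add: phase_def)

lemma norm_character [simp]: "cmod (character \<theta> k) = 1"
  by (simp add: character_def)

lemma character_add: "character \<theta> (k + l) = character \<theta> k * character \<theta> l"
  by (simp add: character_def distrib_right sum.distrib distrib_left exp_add)

lemma character_0 [simp]: "character \<theta> 0 = 1"
  by (simp add: character_def)

lemma character_minus: "character \<theta> (- k) = cnj (character \<theta> k)"
  by (simp add: character_def exp_cnj sum_negf)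

lemma character_axis: "character \<theta> (axis j 1) = phase \<theta> (Some j)"
proof -
  have "(\<Sum>i\<in>UNIV. of_int (axis j (1::int) $ i) * \<theta> $ i) = \<theta> $ j"
    by (subst sum.remove[of _ j]) (auto simp: axis_def intro!: sum.neutral)
  then show ?thesis by (simp add: character_def phase_def)
qed

lemma character_diagram_class:
  "character \<theta> (diagram_class \<alpha>) = (\<Prod>j\<in>#\<alpha>. phase \<theta> (Some j))"
  by (induction \<alpha>) (simp_all add: diagram_class_def character_add character_axis)

text \<open>The basepoint has phase 1, so the copies of \<open>None\<close> that
  \<open>is_diagram\<close> permits do not affect the product.\<close>

lemma prod_phase_is_diagram:
  assumes "is_diagram U \<alpha>"
  shows "(\<Prod>u\<in>#U. phase \<theta> u) = character \<theta> (diagram_class \<alpha>)"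
proof -
  obtain m where "U = image_mset Some \<alpha> + replicate_mset m None"
    using assms by (auto simp: is_diagram_def)
  then show ?thesis
    by (simp add: character_diagram_class multiset.map_comp comp_def phase_def)
qed

text \<open>Telescoping: the factors are exchanged one at a time, and every other factor has modulus
  1, so each exchange costs only its own difference.\<close>

lemma norm_prod_mset_diff_le:
  fixes f g :: "'b \<Rightarrow> complex"
  assumes "\<And>z. cmod (f z) = 1" "\<And>z. cmod (g z) = 1"
  shows "cmod ((\<Prod>z\<in>#M. f z) - (\<Prod>z\<in>#M. g z)) \<le> (\<Sum>z\<in>#M. cmod (f z - g z))"
proof (induction M)
  case (add z M)
  have n: "cmod (\<Prod>z\<in>#M. g z) = 1"
    by (induction M) (simp_all add: norm_mult assms)
  have "f z * (\<Prod>z\<in>#M. f z) - g z * (\<Prod>z\<in>#M. g z)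
      = f z * ((\<Prod>z\<in>#M. f z) - (\<Prod>z\<in>#M. g z)) + (f z - g z) * (\<Prod>z\<in>#M. g z)"
    by (simp add: algebra_simps)
  also have "cmod \<dots> \<le> cmod ((\<Prod>z\<in>#M. f z) - (\<Prod>z\<in>#M. g z)) + cmod (f z - g z)"
    by (rule norm_triangle_le) (simp add: norm_mult assms n)
  finally show ?case using add.IH by simp
qed simp

text \<open>A coupling writes both characters as products over one multiset of pairs, through the
  first and through the second components. Comparing factor by factor bounds the difference by L
  times the cost, and then the infimum over couplings is taken.\<close>

lemma character_W1_lipschitz:
  assumes L: "L \<ge> 0" "\<And>u v. cmod (phase \<theta> u - phase \<theta> v) \<le> L * d u v"
  shows "cmod (character \<theta> (diagram_class \<alpha>) - character \<theta> (diagram_class \<beta>)) \<le> L * W1 d \<alpha> \<beta>"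
proof -
  let ?D = "cmod (character \<theta> (diagram_class \<alpha>) - character \<theta> (diagram_class \<beta>))"
  have le: "?D \<le> L * (\<Sum>(u, v)\<in>#M. d u v)" if "M \<in> couplings \<alpha> \<beta>" for M
  proof -
    have "?D = cmod ((\<Prod>z\<in>#M. phase \<theta> (fst z)) - (\<Prod>z\<in>#M. phase \<theta> (snd z)))"
      using that prod_phase_is_diagram[of "image_mset fst M" \<alpha> \<theta>]
        prod_phase_is_diagram[of "image_mset snd M" \<beta> \<theta>]
      by (simp add: couplings_def multiset.map_comp comp_def)
    also have "\<dots> \<le> (\<Sum>z\<in>#M. cmod (phase \<theta> (fst z) - phase \<theta> (snd z)))"
      by (rule norm_prod_mset_diff_le) simp_all
    also have "\<dots> \<le> (\<Sum>z\<in>#M. L * d (fst z) (snd z))"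
      by (rule sum_mset_mono) (rule L)
    also have "\<dots> = L * (\<Sum>(u, v)\<in>#M. d u v)"
      by (simp add: sum_mset_distrib_left case_prod_beta)
    finally show ?thesis .
  qed
  show ?thesis
  \<comment> \<open>Dividing by L turns the estimate into a lower bound for the infimum. For L = 0,
    any one coupling already shows that the difference vanishes.\<close>
  proof (cases "L = 0")
    case True
    then show ?thesis using le couplings_ne[of \<alpha> \<beta>] by auto
  next
    case False
    then have "?D / L \<le> W1 d \<alpha> \<beta>"
      unfolding W1_def using L(1) le
      by (intro cINF_greatest couplings_ne) (auto simp: field_simps)
    then show ?thesis using False L(1) by (simp add: field_simps)
  qed
qed

text \<open>Moving the negative parts of k and l to the opposite sides yields the two diagrams whose
  \<open>W1\<close> is \<open>rho d k l\<close>. Multiplying by the unimodular value at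
  \<open>c + b\<close> turns the distance of the character at k - l from 1 into a difference between
  these diagrams.\<close>

lemma character_rho_lipschitz:
  fixes k l :: "int ^ 'n::finite"
  assumes "Metric_space UNIV d" "L \<ge> 0" "\<And>u v. cmod (phase \<theta> u - phase \<theta> v) \<le> L * d u v"
  shows "cmod (character \<theta> (k - l) - 1) \<le> L * rho d k l"
proof -
  obtain a b where k: "k = diagram_class a - diagram_class b"
    using exists_diagram_difference by blast
  obtain c e where l: "l = diagram_class c - diagram_class e"
    using exists_diagram_difference by blast
  have "diagram_class (a + e) = (k - l) + diagram_class (c + b)"
    by (simp add: k l diagram_class_add)
  then have "character \<theta> (diagram_class (a + e)) - character \<theta> (diagram_class (c + b))
      = (character \<theta> (k - l) - 1) * character \<theta> (diagram_class (c + b))"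
    by (simp only: character_add left_diff_distrib mult_1_left)
  then have "cmod (character \<theta> (k - l) - 1)
      = cmod (character \<theta> (diagram_class (a + e)) - character \<theta> (diagram_class (c + b)))"
    by (simp add: norm_mult)
  also have "\<dots> \<le> L * W1 d (a + e) (c + b)"
    by (rule character_W1_lipschitz) fact+
  finally show ?thesis
    by (simp add: k l rho_eq[OF assms(1)])
qed

lemma rho_nonneg:
  fixes k l :: "int ^ 'n::finite"
  assumes "Metric_space UNIV d"
  shows "0 \<le> rho d k l"
proof -
  interpret Metric_space UNIV d by fact
  obtain a b where k: "k = diagram_class a - diagram_class b"
    using exists_diagram_difference by blast
  obtain c e where l: "l = diagram_class c - diagram_class e"
    using exists_diagram_difference by blast
  have "0 \<le> (\<Sum>(u, v)\<in>#M. d u v)" for M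
    by (induction M) auto
  then have "0 \<le> W1 d (a + e) (c + b)"
    unfolding W1_def by (intro cINF_greatest couplings_ne)
  then show ?thesis by (simp add: k l rho_eq[OF assms])
qed

section \<open>Lipschitz bounds on the graph, from edges to all pairs\<close>

lemma metric_graph_lipschitz:
  fixes g :: "'v \<Rightarrow> 'b::real_normed_vector"
  assumes G: "metric_graph E d" and "L \<ge> 0"
    and edge: "\<And>u v. (u, v) \<in> parcs E \<Longrightarrow> norm (g u - g v) \<le> L * d u v"
  shows "norm (g u - g v) \<le> L * d u v"
proof -
  interpret pair_graph E using G by (simp add: metric_graph_def)
  let ?c = "\<lambda>(p, q). d p q"
  \<comment> \<open>The edge bounds add up along a walk by the triangle inequality.\<close>
  have walk: "norm (g u - g v) \<le> L * awalk_cost ?c p" if "awalk u p v" for p u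
    using that
  proof (induction p arbitrary: u)
    case Nil
    then show ?case by (simp add: awalk_Nil_iff)
  next
    case (Cons e p)
    then obtain v' where e: "e = (u, v')" "(u, v') \<in> parcs E" "awalk v' p v"
      by (cases e) (auto simp: awalk_Cons_iff)
    have "norm (g u - g v) \<le> norm (g u - g v') + norm (g v' - g v)"
      using norm_triangle_ineq[of "g u - g v'" "g v' - g v"] by simp
    also have "\<dots> \<le> L * d u v' + L * awalk_cost ?c p"
      using edge[OF e(2)] Cons.IH[OF e(3)] by simp
    finally show ?case by (simp add: e distrib_left)
  qed
  \<comment> \<open>The graph distance is an infimum of walk costs in the extended reals. Taking a
    walk within \<epsilon> of it brings the argument back to real numbers.\<close>
  have "(INF p\<in>{p. awalk u p v}. ereal (awalk_cost ?c p)) = ereal (d u v)"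
    using G unfolding metric_graph_def \<mu>_def by blast
  then have near: "\<exists>p. awalk u p v \<and> awalk_cost ?c p < d u v + \<epsilon>" if "\<epsilon> > 0" for \<epsilon>
    using that INF_less_iff[of "\<lambda>p. ereal (awalk_cost ?c p)" "{p. awalk u p v}" "ereal (d u v + \<epsilon>)"]
    by auto
  show ?thesis
  proof (cases "L = 0")
    case True
    then show ?thesis using near[of 1] walk by fastforce
  next
    case False
    have "norm (g u - g v) / L \<le> d u v"
    proof (rule field_le_epsilon)
      fix \<epsilon> :: real assume "\<epsilon> > 0"
      then obtain p where p: "awalk u p v" "awalk_cost ?c p < d u v + \<epsilon>"
        using near by blast
      have "norm (g u - g v) / L \<le> awalk_cost ?c p"
        using walk[OF p(1)] False \<open>L \<ge> 0\<close> by (simp add: field_simps)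
      then show "norm (g u - g v) / L \<le> d u v + \<epsilon>" using p(2) by simp
    qed
    then show ?thesis using False \<open>L \<ge> 0\<close> by (simp add: field_simps)
  qed
qed

lemma edge_min_le:
  fixes E :: "'v::finite pair_pre_digraph"
  assumes "(u, v) \<in> parcs E"
  shows "edge_min E c \<le> c u v"
  unfolding edge_min_def using assms by (intro Min_le) force+

text \<open>The point is that there is an edge at all, since \<open>Min\<close> says nothing about
  the empty set. As \<open>'n\<close> is inhabited, \<open>None\<close> and some
  \<open>Some j\<close> are distinct vertices. An empty set of walks between them would make their
  distance infinite, so a walk exists, and it contains an arc.\<close>

lemma edge_min_pos:
  fixes E :: "'n::finite option pair_pre_digraph"
  assumes G: "metric_graph E d" and pos: "\<And>u v. (u, v) \<in> parcs E \<Longrightarrow> c u v > 0"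
  shows "edge_min E c > 0"
proof -
  interpret pair_graph E using G by (simp add: metric_graph_def)
  fix j :: 'n
  have "(INF p\<in>{p. awalk None p (Some j)}. ereal (awalk_cost (\<lambda>(p, q). d p q) p))
      = ereal (d None (Some j))"
    using G unfolding metric_graph_def \<mu>_def by blast
  then have "\<exists>p. awalk None p (Some j)"
    by (metis (no_types, lifting) Collect_empty_eq INF_empty PInfty_neq_ereal(1) top_ereal_def)
  then obtain p where "awalk None p (Some j)" ..
  then have "parcs E \<noteq> {}"
    by (cases p) (auto simp: awalk_Nil_iff awalk_Cons_iff)
  then show ?thesis
    unfolding edge_min_def using pos by (subst Min_gr_iff) auto
qed

section \<open>Dirichlet energy and the phase function\<close>

context
  fixes E :: "'n::finite option pair_pre_digraph" and w
  assumes w: "conductances E w"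
begin

lemma conductances_nonneg: "0 \<le> w u v"
  using w unfolding conductances_def by (metis less_eq_real_def)

lemma dirichlet_energy_nonneg: "0 \<le> dirichlet_energy w \<theta>"
  by (auto simp: dirichlet_energy_def conductances_nonneg intro!: sum_nonneg)

text \<open>The double sum meets the pair in both orders, which cancels the factor 1/2 in the
  energy. The orders are distinct because u and v are.\<close>

lemma edge_le_dirichlet_energy:
  assumes "u \<noteq> v"
  shows "w u v * (cmod (phase \<theta> u - phase \<theta> v))\<^sup>2 \<le> dirichlet_energy w \<theta>"
proof -
  let ?h = "\<lambda>(u, v). w u v * (cmod (phase \<theta> u - phase \<theta> v))\<^sup>2"
  have "?h (v, u) = ?h (u, v)"
    using w by (simp add: conductances_def norm_minus_commute)
  then have "2 * ?h (u, v) = (\<Sum>z\<in>{(u, v), (v, u)}. ?h z)"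
    using assms by simp
  also have "\<dots> \<le> (\<Sum>z\<in>UNIV \<times> UNIV. ?h z)"
    by (rule sum_mono2) (auto simp: conductances_nonneg)
  also have "\<dots> = 2 * dirichlet_energy w \<theta>"
    by (simp add: dirichlet_energy_def sum.cartesian_product)
  finally show ?thesis by simp
qed

text \<open>Chords of the unit circle have length at most 2. The bound serves to make the energy
  integrable over the torus.\<close>

lemma dirichlet_energy_le:
  "dirichlet_energy w \<theta> \<le> 2 * (\<Sum>u\<in>UNIV. \<Sum>v\<in>UNIV. w u v)"
proof -
  have "cmod (phase \<theta> u - phase \<theta> v) \<le> 2" for u v
    using norm_triangle_ineq4[of "phase \<theta> u" "phase \<theta> v"] by simp
  then have "(cmod (phase \<theta> u - phase \<theta> v))\<^sup>2 \<le> 4" for u v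
    using power_mono[of _ "2::real" 2] by fastforce
  then have "w u v * (cmod (phase \<theta> u - phase \<theta> v))\<^sup>2 \<le> w u v * 4" for u v
    by (intro mult_left_mono conductances_nonneg)
  then have "(\<Sum>u\<in>UNIV. \<Sum>v\<in>UNIV. w u v * (cmod (phase \<theta> u - phase \<theta> v))\<^sup>2)
      \<le> (\<Sum>u\<in>UNIV. \<Sum>v\<in>UNIV. w u v * 4)"
    by (intro sum_mono)
  then show ?thesis
    by (simp add: dirichlet_energy_def flip: sum_distrib_right)
qed

lemma phase_lipschitz:
  assumes "Metric_space UNIV d" and G: "metric_graph E d"
  shows "cmod (phase \<theta> u - phase \<theta> v)
    \<le> sqrt (dirichlet_energy w \<theta>) / (edge_min E d * sqrt (edge_min E w)) * d u v"
proof -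
  interpret Metric_space UNIV d by fact
  interpret pair_graph E using G by (simp add: metric_graph_def)
  have ne: "p \<noteq> q" if "(p, q) \<in> parcs E" for p q
    using that no_loops[of "(p, q)"] by auto
  have d_pos: "edge_min E d > 0"
    using G by (rule edge_min_pos) (simp add: ne mdist_pos_less)
  have w_pos: "edge_min E w > 0"
    using G by (rule edge_min_pos) (use w in \<open>auto simp: conductances_def\<close>)
  show ?thesis
  proof (rule metric_graph_lipschitz[OF G])
    show "0 \<le> sqrt (dirichlet_energy w \<theta>) / (edge_min E d * sqrt (edge_min E w))"
      using d_pos w_pos by (simp add: dirichlet_energy_nonneg)
    fix p q assume e: "(p, q) \<in> parcs E"
    have "edge_min E w * (cmod (phase \<theta> p - phase \<theta> q))\<^sup>2 \<le> dirichlet_energy w \<theta>"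
      using mult_right_mono[OF edge_min_le[OF e], of "(cmod (phase \<theta> p - phase \<theta> q))\<^sup>2" w]
        edge_le_dirichlet_energy[OF ne[OF e], of \<theta>] by simp
    then have "sqrt (edge_min E w) * cmod (phase \<theta> p - phase \<theta> q) \<le> sqrt (dirichlet_energy w \<theta>)"
      using real_sqrt_le_mono by (fastforce simp: real_sqrt_mult)
    then have "cmod (phase \<theta> p - phase \<theta> q) \<le> sqrt (dirichlet_energy w \<theta>) / sqrt (edge_min E w)"
      using w_pos by (simp add: field_simps)
    \<comment> \<open>The inserted factor is at least 1 by minimality of
      \<open>edge_min E d\<close>; it converts a uniform bound on edges into a multiple of the edge
      length.\<close>
    also have "\<dots> \<le> sqrt (dirichlet_energy w \<theta>) / sqrt (edge_min E w) * (d p q / edge_min E d)"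
      using mult_left_mono[of 1 "d p q / edge_min E d" "sqrt (dirichlet_energy w \<theta>) / sqrt (edge_min E w)"]
        edge_min_le[OF e, of d] d_pos w_pos
      by (simp add: dirichlet_energy_nonneg)
    finally show "cmod (phase \<theta> p - phase \<theta> q)
        \<le> sqrt (dirichlet_energy w \<theta>) / (edge_min E d * sqrt (edge_min E w)) * d p q"
      by (simp add: mult_ac)
  qed
qed

end

section \<open>Integration over the torus and the heat kernel\<close>

lemma sets_torus_haar [measurable_cong, simp]: "sets torus_haar = sets borel"
  by (simp add: torus_haar_def)

lemma space_torus_haar [simp]: "space torus_haar = UNIV"
  by (simp add: torus_haar_def)

text \<open>The half-open fundamental box lies between an open box of positive volume and a closed
  box of finite volume, so it can be normalised.\<close>

lemma prob_space_torus_haar: "prob_space (torus_haar :: (real ^ 'n::finite) measure)"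
proof -
  let ?S = "{\<theta> :: real ^ 'n. \<forall>j. 0 \<le> \<theta> $ j \<and> \<theta> $ j < 2 * pi}"
  let ?p = "(\<chi> j. 2 * pi) :: real ^ 'n"
  have S: "?S \<in> sets lborel" by measurable
  have sub: "box 0 ?p \<subseteq> ?S" "?S \<subseteq> cbox 0 ?p"
    by (auto simp: mem_box_cart less_imp_le)
  have "0 < emeasure lborel (box 0 ?p)"
    by (subst emeasure_lborel_box)
      (auto simp: Basis_vec_def inner_axis intro!: prod_pos)
  also have "\<dots> \<le> emeasure lborel ?S"
    by (rule emeasure_mono) fact+
  finally have "emeasure lborel ?S \<noteq> 0" by simp
  moreover have "emeasure lborel ?S \<le> emeasure lborel (cbox 0 ?p)"
    by (rule emeasure_mono[OF sub(2)]) simp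
  then have "emeasure lborel ?S \<noteq> \<infinity>"
    by (metis emeasure_lborel_cbox_finite infinity_ennreal_def leD)
  ultimately show ?thesis
    unfolding torus_haar_def by (rule prob_space_uniform_measure)
qed

lemma borel_measurable_character [measurable]: "(\<lambda>\<theta>. character \<theta> k) \<in> borel_measurable borel"
  unfolding character_def
  by (intro borel_measurable_continuous_onI continuous_intros)

lemma borel_measurable_phase [measurable]: "(\<lambda>\<theta>. phase \<theta> u) \<in> borel_measurable borel"
  unfolding phase_def
  by (cases u) (auto intro!: borel_measurable_continuous_onI continuous_intros)

lemma borel_measurable_dirichlet_energy [measurable]:
  "dirichlet_energy w \<in> borel_measurable borel"
proof -
  have "dirichlet_energy w
      = (\<lambda>\<theta>. 1 / 2 * (\<Sum>u\<in>UNIV. \<Sum>v\<in>UNIV. w u v * (cmod (phase \<theta> u - phase \<theta> v))\<^sup>2))"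
    by (simp add: fun_eq_iff dirichlet_energy_def)
  then show ?thesis by simp
qed

lemma integrable_torus_haar_bounded:
  fixes g :: "real ^ 'n::finite \<Rightarrow> 'b::{banach, second_countable_topology}"
  assumes "g \<in> borel_measurable borel" "\<And>\<theta>. norm (g \<theta>) \<le> B"
  shows "integrable torus_haar g"
proof -
  interpret prob_space "torus_haar :: (real ^ 'n) measure" by (rule prob_space_torus_haar)
  show ?thesis
    using assms by (intro integrable_const_bound[of _ B]) auto
qed

text \<open>The left-hand side is the squared norm of \<open>k\<^sub>\<alpha> - k\<^sub>\<beta>\<close> in the reproducing kernel Hilbert space.\<close>

lemma heat_kernel_second_difference:
  assumes w: "conductances E w" and "t > 0"
  shows "heat_kernel w t \<alpha> \<alpha> - heat_kernel w t \<alpha> \<beta> - heat_kernel w t \<beta> \<alpha> + heat_kernel w t \<beta> \<beta>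
    = of_real (\<integral>\<theta>. (cmod (character \<theta> (\<alpha> - \<beta>) - 1))\<^sup>2 * exp (- t * dirichlet_energy w \<theta>) \<partial>torus_haar)"
proof -
  let ?e = "\<lambda>\<theta>. exp (- t * dirichlet_energy w \<theta>)"
  have k: "heat_kernel w t \<gamma> \<delta> = (\<integral>\<theta>. of_real (?e \<theta>) * character \<theta> (\<gamma> - \<delta>) \<partial>torus_haar)" for \<gamma> \<delta>
    unfolding heat_kernel_def heat_measure_def
    by (subst integral_density) (simp_all add: scaleR_conv_of_real)
  have "0 \<le> t * dirichlet_energy w \<theta>" for \<theta>
    using \<open>t > 0\<close> dirichlet_energy_nonneg[OF w] by simp
  then have int: "integrable torus_haar (\<lambda>\<theta>. of_real (?e \<theta>) * character \<theta> \<gamma>)" for \<gamma>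
    by (intro integrable_torus_haar_bounded[of _ 1]) (simp_all add: norm_mult)
  have pointwise: "of_real (?e \<theta>) * character \<theta> (\<alpha> - \<alpha>) - of_real (?e \<theta>) * character \<theta> (\<alpha> - \<beta>)
        - of_real (?e \<theta>) * character \<theta> (\<beta> - \<alpha>) + of_real (?e \<theta>) * character \<theta> (\<beta> - \<beta>)
      = of_real ((cmod (character \<theta> (\<alpha> - \<beta>) - 1))\<^sup>2 * ?e \<theta>)" for \<theta>
  proof -
    let ?z = "character \<theta> (\<alpha> - \<beta>)"
    have "character \<theta> (\<beta> - \<alpha>) = cnj ?z"
      by (simp flip: character_minus)
    moreover have "?z * cnj ?z = 1"
      by (simp add: complex_norm_square[symmetric])
    then have "of_real ((cmod (?z - 1))\<^sup>2) = 2 - ?z - cnj ?z"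
      by (simp only: complex_norm_square) (simp add: algebra_simps)
    ultimately show ?thesis
      by (simp only: of_real_mult) (simp add: algebra_simps)
  qed
  show ?thesis
    \<comment> \<open>The right-hand integrand is expanded into its four kernel terms. Each is
      integrable, so the integral splits by linearity.\<close>
    unfolding k integral_complex_of_real[symmetric] pointwise[symmetric]
    by (simp only: int Bochner_Integration.integral_diff Bochner_Integration.integral_add
        Bochner_Integration.integrable_diff)
qed

section \<open>Cauchy-Schwarz and point differences in the reproducing kernel Hilbert space\<close>

lemma complex_hilbert_spaceD:
  assumes "is_complex_hilbert_space H ip"
  shows "f \<in> H \<Longrightarrow> g \<in> H \<Longrightarrow> (\<lambda>x. f x + g x) \<in> H"
    and "f \<in> H \<Longrightarrow> (\<lambda>x. c * f x) \<in> H"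
    and "f \<in> H \<Longrightarrow> g \<in> H \<Longrightarrow> h \<in> H \<Longrightarrow> ip (\<lambda>x. f x + g x) h = ip f h + ip g h"
    and "f \<in> H \<Longrightarrow> h \<in> H \<Longrightarrow> ip (\<lambda>x. c * f x) h = c * ip f h"
    and "f \<in> H \<Longrightarrow> g \<in> H \<Longrightarrow> ip g f = cnj (ip f g)"
    and "f \<in> H \<Longrightarrow> 0 \<le> Re (ip f f)"
    and "f \<in> H \<Longrightarrow> ip f f = 0 \<Longrightarrow> f = (\<lambda>_. 0)"
  using assms unfolding is_complex_hilbert_space_def by blast+

lemma complex_hilbert_space_Cauchy_Schwarz:
  assumes "is_complex_hilbert_space H ip" and f: "f \<in> H" and g: "g \<in> H"
  shows "cmod (ip f g) \<le> ip_norm ip f * ip_norm ip g"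
proof -
  note addH = complex_hilbert_spaceD(1)[OF assms(1)] and scaleH = complex_hilbert_spaceD(2)[OF assms(1)]
    and add = complex_hilbert_spaceD(3)[OF assms(1)] and scale = complex_hilbert_spaceD(4)[OF assms(1)]
    and sym = complex_hilbert_spaceD(5)[OF assms(1)] and nonneg = complex_hilbert_spaceD(6)[OF assms(1)]
    and definite = complex_hilbert_spaceD(7)[OF assms(1)]
  have real: "ip p p = of_real (Re (ip p p))" if "p \<in> H" for p
    using sym[OF that that] by (simp add: complex_eq_iff)
  show ?thesis
  proof (cases "ip g g = 0")
    case True
    \<comment> \<open>Here g is the zero function by definiteness, so it suffices that the zero
      function, written as a multiple of f, pairs to 0 with f.\<close>
    have "ip (\<lambda>x. 0 * f x) f = 0"
      unfolding scale[OF f f] by simp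
    then have "ip f g = 0"
      using sym[OF g f] definite[OF g True] by simp
    then show ?thesis
      using nonneg[OF f] nonneg[OF g] by (simp add: ip_norm_def)
  next
    case False
    define G where "G = Re (ip g g)"
    have gg: "ip g g = of_real G" using real[OF g] by (simp add: G_def)
    have "G > 0"
      using False nonneg[OF g] unfolding gg by (simp add: less_le)
    \<comment> \<open>This c makes h the component of f orthogonal to g. The inequality is the
      nonnegativity of its squared norm.\<close>
    define c where "c = - ip f g / of_real G"
    define h where "h = (\<lambda>x. f x + c * g x)"
    have cg: "(\<lambda>x. c * g x) \<in> H" and h: "h \<in> H"
      unfolding h_def by (intro addH scaleH f g)+
    \<comment> \<open>Linearity is given in the first argument only; conjugate symmetry transfers it
      to the second.\<close>
    have hf: "ip p h = ip p f + cnj c * ip p g" if "p \<in> H" for p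
    proof -
      have "ip h p = ip f p + c * ip g p"
        unfolding h_def add[OF f cg that] scale[OF g that] ..
      then show ?thesis
        using sym[OF h that] sym[OF f that] sym[OF g that] by simp
    qed
    have "ip h h = ip f h + c * ip g h"
      using add[OF f cg h] scale[OF g h, of c] by (simp only: h_def[symmetric])
    also have "\<dots> = ip f f - of_real ((cmod (ip f g))\<^sup>2 / G)"
      using \<open>G > 0\<close> complex_norm_square[of "ip f g"] unfolding hf[OF f] hf[OF g] gg sym[OF f g] c_def
      by (simp add: field_simps power2_eq_square)
    finally have "0 \<le> Re (ip f f) - (cmod (ip f g))\<^sup>2 / G"
      using nonneg[OF h] by simp
    then have "(cmod (ip f g))\<^sup>2 \<le> Re (ip f f) * G"
      using \<open>G > 0\<close> by (simp add: field_simps)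
    then have "sqrt ((cmod (ip f g))\<^sup>2) \<le> sqrt (Re (ip f f) * G)"
      by (rule real_sqrt_le_mono)
    then show ?thesis by (simp add: ip_norm_def real_sqrt_mult G_def)
  qed
qed

lemma rkhs_difference_bound:
  assumes "is_rkhs H ip k" and f: "f \<in> H"
  shows "cmod (f \<alpha> - f \<beta>) \<le> ip_norm ip f * sqrt (Re (k \<alpha> \<alpha> - k \<alpha> \<beta> - k \<beta> \<alpha> + k \<beta> \<beta>))"
proof -
  let ?K = "\<lambda>\<alpha> \<beta>. k \<beta> \<alpha>"
  \<comment> \<open>h represents the functional taking f to f \<alpha> - f \<beta>. Writing the
    difference with the scalar -1 lets the rules for sums and multiples apply.\<close>
  define h where "h = (\<lambda>x. k x \<alpha> + (- 1) * k x \<beta>)"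
  have hs: "is_complex_hilbert_space H ip" and kH: "\<And>\<alpha>. ?K \<alpha> \<in> H"
    and repr: "\<And>f \<alpha>. f \<in> H \<Longrightarrow> f \<alpha> = ip f (?K \<alpha>)"
    using assms(1) unfolding is_rkhs_def by blast+
  note sym = complex_hilbert_spaceD(5)[OF hs]
  have minus: "(\<lambda>x. (- 1) * k x \<beta>) \<in> H"
    by (rule complex_hilbert_spaceD(2)[OF hs kH])
  then have h: "h \<in> H"
    unfolding h_def by (rule complex_hilbert_spaceD(1)[OF hs kH])
  have left: "ip h p = ip (?K \<alpha>) p - ip (?K \<beta>) p" if "p \<in> H" for p
    unfolding h_def complex_hilbert_spaceD(3)[OF hs kH minus that]
      complex_hilbert_spaceD(4)[OF hs kH that] by simp
  have right: "ip p h = p \<alpha> - p \<beta>" if "p \<in> H" for p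
    unfolding sym[OF h that] left[OF that] sym[OF that kH]
    by (simp flip: repr[OF that])
  have "cmod (f \<alpha> - f \<beta>) \<le> ip_norm ip f * ip_norm ip h"
    using complex_hilbert_space_Cauchy_Schwarz[OF hs f h] right[OF f] by simp
  \<comment> \<open>Applying the functional to its own representer gives the squared norm h \<alpha>
    - h \<beta>, which is the second difference of the kernel.\<close>
  also have "ip_norm ip h = sqrt (Re (k \<alpha> \<alpha> - k \<alpha> \<beta> - k \<beta> \<alpha> + k \<beta> \<beta>))"
    unfolding ip_norm_def right[OF h] by (simp add: h_def algebra_simps)
  finally show ?thesis .
qed

section \<open>The Lipschitz estimate\<close>

lemma Lip_le:
  assumes "C \<ge> 0" and "\<And>\<alpha> \<beta>. e2 (f \<alpha>) (f \<beta>) \<le> C * e1 \<alpha> \<beta>"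
  shows "Lip e1 e2 f \<le> ennreal C"
  unfolding Lip_def
proof (rule SUP_least, clarify)
  fix \<alpha> \<beta>
  have le: "ennreal (e2 (f \<alpha>) (f \<beta>)) \<le> ennreal C * ennreal (e1 \<alpha> \<beta>)"
    using assms by (simp add: ennreal_leI flip: ennreal_mult')
  show "ennreal (e2 (f \<alpha>) (f \<beta>)) / ennreal (e1 \<alpha> \<beta>) \<le> ennreal C"
  proof (cases "ennreal (e1 \<alpha> \<beta>) = 0")
    \<comment> \<open>The numerator is then 0 as well, and 0 / 0 is 0 in
      \<open>ennreal\<close>.\<close>
    case True
    then show ?thesis using le by simp
  next
    case False
    have "ennreal (e2 (f \<alpha>) (f \<beta>)) / ennreal (e1 \<alpha> \<beta>)
        \<le> ennreal C * ennreal (e1 \<alpha> \<beta>) / ennreal (e1 \<alpha> \<beta>)"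
      by (rule divide_right_mono_ennreal) (fact le)
    then show ?thesis using False by (simp add: ennreal_mult_divide_eq)
  qed
qed

theorem corollary5p3:
  fixes A :: "'a::metric_space set"
    and x :: "'n::finite \<Rightarrow> 'a"
    and E :: "'n option pair_pre_digraph"
    and w :: "'n option \<Rightarrow> 'n option \<Rightarrow> real"
    and t :: real
    and H :: "(int ^ 'n \<Rightarrow> complex) set"
    and ip :: "(int ^ 'n \<Rightarrow> complex) \<Rightarrow> (int ^ 'n \<Rightarrow> complex) \<Rightarrow> complex"
    and f :: "int ^ 'n \<Rightarrow> complex"
  assumes "A \<noteq> {}"
    and "bij_betw x UNIV (- A)"
    and "Metric_space UNIV (d1_quot A x)"
    and "metric_graph E (d1_quot A x)"
    and "conductances E w"
    and "t > 0"
    and "is_rkhs H ip (heat_kernel w t)"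
    and "f \<in> H"
  shows "Lip (rho (d1_quot A x)) dist f
    \<le> ennreal (pi / (2 * edge_min E (d1_quot A x) * sqrt (edge_min E w)) * ip_norm ip f *
        sqrt (\<integral>\<theta>. dirichlet_energy w \<theta> * exp (- t * dirichlet_energy w \<theta>) \<partial>torus_haar))"
proof (rule Lip_le)
  let ?d = "d1_quot A x"
  let ?I = "\<integral>\<theta>. dirichlet_energy w \<theta> * exp (- t * dirichlet_energy w \<theta>) \<partial>torus_haar"
  note ms = \<open>Metric_space UNIV (d1_quot A x)\<close> and G = \<open>metric_graph E (d1_quot A x)\<close>
    and w = \<open>conductances E w\<close> and rkhs = \<open>is_rkhs H ip (heat_kernel w t)\<close>
  interpret Metric_space UNIV ?d by (fact ms)
  interpret pair_graph E using G by (simp add: metric_graph_def)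
  define D where "D = edge_min E ?d * sqrt (edge_min E w)"
  have "u \<noteq> v" if "(u, v) \<in> parcs E" for u v
    using that no_loops[of "(u, v)"] by auto
  then have "edge_min E ?d > 0"
    by (intro edge_min_pos[OF G]) (simp add: mdist_pos_less)
  moreover have "edge_min E w > 0"
    using G by (rule edge_min_pos) (use w in \<open>auto simp: conductances_def\<close>)
  ultimately have D: "D > 0" by (simp add: D_def)
  have nonneg: "0 \<le> dirichlet_energy w \<theta>" for \<theta>
    by (rule dirichlet_energy_nonneg[OF w])
  have I: "0 \<le> ?I" by (rule Bochner_Integration.integral_nonneg) (simp add: nonneg)
  have "is_complex_hilbert_space H ip"
    using rkhs unfolding is_rkhs_def by (rule conjunct1)
  from complex_hilbert_spaceD(6)[OF this \<open>f \<in> H\<close>] have f: "0 \<le> ip_norm ip f" by (simp add: ip_norm_def)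
  have const: "pi / (2 * edge_min E ?d * sqrt (edge_min E w)) = pi / 2 / D"
    by (simp add: D_def)
  show "0 \<le> pi / (2 * edge_min E ?d * sqrt (edge_min E w)) * ip_norm ip f * sqrt ?I"
    unfolding const using D I f by simp
  fix \<alpha> \<beta>
  let ?r = "rho ?d \<alpha> \<beta>"
  have char: "cmod (character \<theta> (\<alpha> - \<beta>) - 1) \<le> sqrt (dirichlet_energy w \<theta>) / D * ?r" for \<theta>
    using D nonneg unfolding D_def
    by (intro character_rho_lipschitz[OF ms] phase_lipschitz[OF w ms G]) simp
  have r: "0 \<le> ?r" by (rule rho_nonneg) (fact ms)
  \<comment> \<open>Squaring the bound on the character separates the energy, which depends on
    \<theta>, from the constant \<open>(?r / D)\<^sup>2\<close>, which leaves the integral.\<close>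
  have le: "(cmod (character \<theta> (\<alpha> - \<beta>) - 1))\<^sup>2 * exp (- t * dirichlet_energy w \<theta>)
      \<le> (?r / D)\<^sup>2 * (dirichlet_energy w \<theta> * exp (- t * dirichlet_energy w \<theta>))" for \<theta>
    using mult_right_mono[OF power_mono[OF char norm_ge_zero, of \<theta> 2],
        of "exp (- t * dirichlet_energy w \<theta>)"] nonneg[of \<theta>]
    by (simp add: power_mult_distrib power_divide mult_ac)
  have "exp (- t * dirichlet_energy w \<theta>) \<le> 1" for \<theta>
    using \<open>t > 0\<close> nonneg[of \<theta>] by simp
  then have int_right: "integrable torus_haar
      (\<lambda>\<theta>. dirichlet_energy w \<theta> * exp (- t * dirichlet_energy w \<theta>))"
    using nonneg dirichlet_energy_le[OF w]
    by (intro integrable_torus_haar_bounded[of _ "2 * (\<Sum>u\<in>UNIV. \<Sum>v\<in>UNIV. w u v)"])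
      (auto simp: abs_mult intro: order_trans[OF mult_left_le])
  have "(\<integral>\<theta>. (cmod (character \<theta> (\<alpha> - \<beta>) - 1))\<^sup>2 * exp (- t * dirichlet_energy w \<theta>) \<partial>torus_haar)
      \<le> (\<integral>\<theta>. (?r / D)\<^sup>2 * (dirichlet_energy w \<theta> * exp (- t * dirichlet_energy w \<theta>)) \<partial>torus_haar)"
    \<comment> \<open>Only the majorant has to be shown integrable: a non-integrable left side would
      have integral 0 by convention, and the majorant is nonnegative.\<close>
    by (rule integral_mono') (use int_right le nonneg in simp_all)
  also have "\<dots> = (?r / D)\<^sup>2 * ?I" by simp
  finally have "Re (heat_kernel w t \<alpha> \<alpha> - heat_kernel w t \<alpha> \<beta> - heat_kernel w t \<beta> \<alpha>
      + heat_kernel w t \<beta> \<beta>) \<le> (?r / D)\<^sup>2 * ?I"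
    unfolding heat_kernel_second_difference[OF w \<open>t > 0\<close>] by simp
  then have "sqrt (Re (heat_kernel w t \<alpha> \<alpha> - heat_kernel w t \<alpha> \<beta> - heat_kernel w t \<beta> \<alpha>
      + heat_kernel w t \<beta> \<beta>)) \<le> sqrt ((?r / D)\<^sup>2 * ?I)"
    by (rule real_sqrt_le_mono)
  also have "\<dots> = ?r / D * sqrt ?I"
    using D r by (simp add: real_sqrt_mult)
  finally have "dist (f \<alpha>) (f \<beta>) \<le> ip_norm ip f * (?r / D * sqrt ?I)"
    using rkhs_difference_bound[OF rkhs \<open>f \<in> H\<close>, of \<alpha> \<beta>] f
    by (metis (no_types, lifting) dist_norm mult_left_mono order_trans)
  \<comment> \<open>The right-hand side is nonnegative and \<open>pi / 2\<close> is at least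
    1.\<close>
  also have "\<dots> \<le> pi / 2 * (ip_norm ip f * (?r / D * sqrt ?I))"
    using mult_right_mono[of 1 "pi / 2" "ip_norm ip f * (?r / D * sqrt ?I)"] D I f r pi_ge_two
    by simp
  finally show "dist (f \<alpha>) (f \<beta>)
      \<le> pi / (2 * edge_min E ?d * sqrt (edge_min E w)) * ip_norm ip f * sqrt ?I * ?r"
    unfolding const by (simp add: mult_ac)
qed

end
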